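(* Let $n\ge1$ and $0\le k\le n$. There is a bijection $\Phi:\mathrm{RInc}_k(2\times n)\to\mathrm{RInc}_k(2\times n)$ such that for every $T\in\mathrm{RInc}_k(2\times n)$ the second row of $\Phi(T)$ equals the second row of $T$ and \[ \mathrm{maj}(\Phi(T))=\mathrm{amaj}(T)+n-k. \]
   Context: $\mathrm{RInc}_k(2\times n)$ is the set of $2\times n$ arrays $T=(T_{i,j})$ (row 1 on top) of positive integers with strictly increasing rows, weakly increasing columns ($T_{1,j}\le T_{2,j}$), and set of entries exactly $\{1,\ldots,2n-k\}$. For such $T$, $i$ is a descent if $i$ occurs in row 1 and $i+1$ occurs in row 2, and an ascent if $i$ occurs in row 2 and $i+1$ occurs in row 1; $\mathrm{maj}(T)$ (resp. $\mathrm{amaj}(T)$) is the sum of the descents (resp. ascents) of $T$. *)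

theory Defs
  imports Main
begin

(* A 2 x n array is the pair of its rows (top row, bottom row), both lists of length n.
   Lists are indexed from 0, so T_{1,j} is fst T ! (j - 1). *)
type_synonym array2 = "nat list \<times> nat list"

(* Positivity of the entries is part of the last conjunct.  For k \<le> n, the only case used,
   the subtraction on nat is the true one. *)
definition RInc :: "nat \<Rightarrow> nat \<Rightarrow> array2 set" where
  "RInc k n = {T. length (fst T) = n \<and> length (snd T) = n \<and>
     sorted_wrt (<) (fst T) \<and> sorted_wrt (<) (snd T) \<and>
     (\<forall>j<n. fst T ! j \<le> snd T ! j) \<and>
     set (fst T) \<union> set (snd T) = {1..2 * n - k}}"

definition descents :: "array2 \<Rightarrow> nat set" where
  "descents T = {i. i \<in> set (fst T) \<and> i + 1 \<in> set (snd T)}"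

definition ascents :: "array2 \<Rightarrow> nat set" where
  "ascents T = {i. i \<in> set (snd T) \<and> i + 1 \<in> set (fst T)}"

definition maj :: "array2 \<Rightarrow> nat" where
  "maj T = \<Sum>(descents T)"

definition amaj :: "array2 \<Rightarrow> nat" where
  "amaj T = \<Sum>(ascents T)"

end

theory Submission
  imports Defs
begin

text \<open>
  Fix the second row, with entry set \<open>B\<close>, and let \<open>C = {1..2n - k} - B\<close>. The first row has entry
  set \<open>C \<union> D\<close> with \<open>D \<subseteq> B\<close>. Along a maximal interval of \<open>B\<close> the difference between the numbers of
  first-row and second-row entries read so far weakly decreases, so the column condition depends
  only on how many elements of \<open>D\<close> lie in each such interval. Hence \<open>D\<close> may be rotated by one step
  inside every maximal interval of \<open>B\<close>. This turns the ascents \<open>i\<close> with \<open>i + 1 \<in> D\<close> into the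
  descents \<open>i\<close> with \<open>i \<in> D\<close>; the remaining descents and ascents depend on \<open>B\<close> only, and telescoping
  shows that their sums differ by \<open>card C = n - k\<close>.
\<close>

section \<open>Rotation inside the maximal intervals of a set\<close>

definition interval_end :: "nat set \<Rightarrow> nat \<Rightarrow> nat" where
  "interval_end B x = (LEAST e. x \<le> e \<and> Suc e \<notin> B)"

text \<open>If \<open>0 \<in> B\<close>, the truncated \<open>x - 1\<close> would fix
  \<open>0\<close>, which could then also be the image of \<open>1\<close>; hence the assumption
  \<open>0 \<notin> B\<close> for injectivity below.\<close>

definition rotate_down :: "nat set \<Rightarrow> nat \<Rightarrow> nat" where
  "rotate_down B x = (if x \<notin> B then x else if x - 1 \<in> B then x - 1 else interval_end B x)"

lemma interval_end:
  assumes "finite B"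
  shows interval_end_ge: "x \<le> interval_end B x"
    and Suc_interval_end: "Suc (interval_end B x) \<notin> B"
    and interval_end_subset: "x \<in> B \<Longrightarrow> {x..interval_end B x} \<subseteq> B"
proof -
  let ?P = "\<lambda>e. x \<le> e \<and> Suc e \<notin> B"
  obtain M where M: "\<And>y. y \<in> B \<Longrightarrow> y \<le> M"
    using assms by (auto simp: finite_nat_set_iff_bounded_le)
  have "?P (max x M)"
    by (metis M max.cobounded1 max.cobounded2 not_less_eq_eq)
  then have P: "?P (interval_end B x)"
    unfolding interval_end_def by (rule LeastI)
  then show "x \<le> interval_end B x" "Suc (interval_end B x) \<notin> B"
    by auto
  show "{x..interval_end B x} \<subseteq> B" if "x \<in> B"
  proof
    fix y assume y: "y \<in> {x..interval_end B x}"
    show "y \<in> B"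
    proof (cases "y = x")
      case False
      then have "x \<le> y - 1" "y - 1 < interval_end B x" "Suc (y - 1) = y"
        using y by auto
      then show ?thesis
        using not_less_Least[of "y - 1" ?P] unfolding interval_end_def by auto
    qed (use that in simp)
  qed
qed

lemma rotate_down_notin [simp]: "x \<notin> B \<Longrightarrow> rotate_down B x = x"
  by (simp add: rotate_down_def)

lemma rotate_down_in:
  assumes "finite B" "x \<in> B"
  shows "rotate_down B x \<in> B"
  using interval_end_subset[OF assms] interval_end_ge[OF assms(1), of x] assms(2)
  by (auto simp: rotate_down_def)

text \<open>Whether the successor of the image lies in \<open>B\<close> reveals whether
  \<open>x\<close> was moved down by one or wrapped from the start of its interval to the
  end.\<close>

lemma Suc_rotate_down:
  assumes "finite B" "0 \<notin> B" "x \<in> B"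
  shows "Suc (rotate_down B x) = x \<and> x - 1 \<in> B \<or> Suc (rotate_down B x) \<notin> B \<and> x - 1 \<notin> B"
  using assms Suc_interval_end[OF assms(1), of x]
  by (cases x) (auto simp: rotate_down_def)

lemma inj_rotate_down:
  assumes "finite B" "0 \<notin> B"
  shows "inj (rotate_down B)"
proof (rule injI)
  fix x y assume eq: "rotate_down B x = rotate_down B y"
  show "x = y"
  proof (cases "x \<in> B \<and> y \<in> B")
    case False
    then show ?thesis
      using eq rotate_down_in[OF assms(1)] by (metis rotate_down_notin)
  next
    case True
    note step = Suc_rotate_down[OF assms, of x] Suc_rotate_down[OF assms, of y]
    show ?thesis
    proof (cases "x - 1 \<in> B")
      case True
      then show ?thesis using \<open>x \<in> B \<and> y \<in> B\<close> step eq by auto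
    next
      case False
      \<comment> \<open>What remains is two interval starts that wrap to the same end. If they
        differed, the interval from the smaller one would contain the predecessor of the
        larger.\<close>
      then have starts: "x - 1 \<notin> B" "y - 1 \<notin> B"
        using True step eq by auto
      then have ends: "interval_end B x = interval_end B y"
        using eq True by (simp add: rotate_down_def)
      have sub: "{x..interval_end B x} \<subseteq> B" "{y..interval_end B x} \<subseteq> B"
        using interval_end_subset[OF assms(1)] True ends by metis+
      have le: "x \<le> interval_end B x" "y \<le> interval_end B x"
        using interval_end_ge[OF assms(1)] ends by metis+
      have "\<not> x < y"
      proof
        assume "x < y"
        then have "y - 1 \<in> {x..interval_end B x}" using le by auto
        then show False using sub starts by blast
      qed
      moreover have "\<not> y < x"
      proof
        assume "y < x"
        then have "x - 1 \<in> {y..interval_end B x}" using le by auto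
        then show False using sub starts by blast
      qed
      ultimately show ?thesis by simp
    qed
  qed
qed

text \<open>No interval of \<open>B\<close> crosses from \<open>m\<close> to \<open>Suc m\<close>,
  so the rotation cannot carry an element past \<open>m\<close>.\<close>

lemma rotate_down_le:
  assumes "finite B" "x \<le> m" "Suc m \<notin> B"
  shows "rotate_down B x \<le> m"
proof (cases "x \<in> B \<and> x - 1 \<notin> B")
  case True
  then have "interval_end B x \<le> m"
    unfolding interval_end_def using assms by (intro Least_le) auto
  then show ?thesis using True by (simp add: rotate_down_def)
next
  case False
  then show ?thesis using assms by (auto simp: rotate_down_def)
qed

section \<open>The column condition as a counting condition\<close>

lemma card_nth_le:
  fixes xs :: "'a::linorder list"
  assumes "sorted_wrt (<) xs"
  shows "card {x \<in> set xs. x \<le> m} = card {j. j < length xs \<and> xs ! j \<le> m}"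
proof -
  have inj: "inj_on ((!) xs) {j. j < length xs \<and> xs ! j \<le> m}"
    using assms by (auto simp: inj_on_def nth_eq_iff_index_eq strict_sorted_iff)
  have "(!) xs ` {j. j < length xs \<and> xs ! j \<le> m} = {x \<in> set xs. x \<le> m}"
    by (auto simp: in_set_conv_nth)
  then show ?thesis
    using card_image[OF inj] by simp
qed

text \<open>In a strictly increasing list the entry at index \<open>j\<close> is at most
  \<open>m\<close> exactly when more than \<open>j\<close> entries are. So the column condition
  depends on the entry sets alone, and these are what the rotation acts on.\<close>

lemma nth_le_nth_iff_card_le:
  fixes xs ys :: "'a::linorder list"
  assumes "sorted_wrt (<) xs" "sorted_wrt (<) ys" "length xs = n" "length ys = n"
  shows "(\<forall>j<n. xs ! j \<le> ys ! j) \<longleftrightarrow>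
    (\<forall>m. card {y \<in> set ys. y \<le> m} \<le> card {x \<in> set xs. x \<le> m})"
proof (intro iffI allI impI)
  fix m assume "\<forall>j<n. xs ! j \<le> ys ! j"
  then have "{j. j < length ys \<and> ys ! j \<le> m} \<subseteq> {j. j < length xs \<and> xs ! j \<le> m}"
    using assms by (auto intro: order_trans)
  then show "card {y \<in> set ys. y \<le> m} \<le> card {x \<in> set xs. x \<le> m}"
    unfolding card_nth_le[OF assms(1)] card_nth_le[OF assms(2)]
    by (intro card_mono) auto
next
  fix j assume le: "\<forall>m. card {y \<in> set ys. y \<le> m} \<le> card {x \<in> set xs. x \<le> m}" and j: "j < n"
  show "xs ! j \<le> ys ! j"
  proof (rule ccontr)
    assume "\<not> xs ! j \<le> ys ! j"
    \<comment> \<open>At the threshold \<open>ys ! j\<close>, at most \<open>j\<close> entries of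
      \<open>xs\<close> are counted, but at least \<open>j + 1\<close> entries of
      \<open>ys\<close>.\<close>
    then have "i < j" if "i < length xs" "xs ! i \<le> ys ! j" for i
      using that sorted_wrt_nth_less[OF assms(1), of j i] by (cases i j rule: linorder_cases) auto
    then have "card {i. i < length xs \<and> xs ! i \<le> ys ! j} \<le> card {..<j}"
      by (intro card_mono) auto
    moreover have "ys ! i \<le> ys ! j" if "i \<le> j" for i
      using that j assms sorted_wrt_nth_less[OF assms(2), of i j] by (cases "i = j") auto
    then have "card {..j} \<le> card {i. i < length ys \<and> ys ! i \<le> ys ! j}"
      using j assms by (intro card_mono) auto
    ultimately show False
      using le[rule_format, of "ys ! j"]
      unfolding card_nth_le[OF assms(1)] card_nth_le[OF assms(2)] by simp
  qed
qed

text \<open>At a threshold that no interval crosses, the count for \<open>A\<close> does not drop.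
  Otherwise compare with the end \<open>e\<close> of the interval: going back from \<open>e\<close>
  to \<open>m\<close>, the count for \<open>B\<close> falls by exactly \<open>e - m\<close>, that
  for the image of \<open>A\<close> by at most as much.\<close>

lemma card_le_rotate_down:
  assumes "finite A" "finite B" "0 \<notin> B"
    and dom: "\<And>m. card {y \<in> B. y \<le> m} \<le> card {x \<in> A. x \<le> m}"
  shows "card {y \<in> B. y \<le> m} \<le> card {x \<in> rotate_down B ` A. x \<le> m}"
proof -
  let ?A' = "rotate_down B ` A"
  have end_case: "card {y \<in> B. y \<le> e} \<le> card {x \<in> ?A'. x \<le> e}" if "Suc e \<notin> B" for e
  proof -
    have "card {x \<in> A. x \<le> e} = card (rotate_down B ` {x \<in> A. x \<le> e})"
      using inj_rotate_down[OF assms(2,3)] by (metis card_image inj_on_subset subset_UNIV)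
    also have "\<dots> \<le> card {x \<in> ?A'. x \<le> e}"
      using assms(1) rotate_down_le[OF assms(2) _ that] by (intro card_mono) auto
    finally show ?thesis using dom[of e] by simp
  qed
  show ?thesis
  proof (cases "Suc m \<in> B")
    case True
    define e where "e = interval_end B (Suc m)"
    have me: "m < e" and "Suc e \<notin> B" and sub: "{m<..e} \<subseteq> B"
      using interval_end[OF assms(2), of "Suc m"] True
      by (auto simp: e_def atLeastSucAtMost_greaterThanAtMost)
    have "{y \<in> B. y \<le> e} = {y \<in> B. y \<le> m} \<union> {m<..e}"
      using me sub by auto
    then have "card {y \<in> B. y \<le> e} = card {y \<in> B. y \<le> m} + (e - m)"
      using assms(2) card_Un_disjoint[of "{y \<in> B. y \<le> m}" "{m<..e}"] by fastforce
    moreover have "card {x \<in> ?A'. x \<le> e} \<le> card ({x \<in> ?A'. x \<le> m} \<union> {m<..e})"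
      using assms(1) by (intro card_mono) auto
    then have "card {x \<in> ?A'. x \<le> e} \<le> card {x \<in> ?A'. x \<le> m} + (e - m)"
      using card_Un_le[of "{x \<in> ?A'. x \<le> m}" "{m<..e}"] by simp
    ultimately show ?thesis
      using end_case[OF \<open>Suc e \<notin> B\<close>] by simp
  qed (rule end_case)
qed

text \<open>Each maximal interval of \<open>C\<close> contributes its last element minus the
  predecessor of its first, which is its length. As \<open>N \<in> B\<close>, every such interval is
  followed by an element of \<open>B\<close>. Formally, the sums of \<open>j\<close> and of
  \<open>j - 1\<close> over \<open>C\<close> share the terms with \<open>i\<close> and
  \<open>Suc i\<close> both in \<open>C\<close>.\<close>

lemma sum_block_ends:
  fixes C :: "nat set"
  assumes "B \<union> C = {1..N}" "B \<inter> C = {}" "N \<in> B"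
  shows "\<Sum>{i \<in> C. Suc i \<in> B} = \<Sum>{i \<in> B. Suc i \<in> C} + card C"
proof -
  have fin: "finite B" "finite C"
    using assms(1) by (metis finite_Un finite_atLeastAtMost)+
  have pos: "0 < i" if "i \<in> C" for i
    using that equalityD1[OF assms(1)] by force
  have up: "Suc i \<in> B \<union> C" if "i \<in> C" for i
  proof -
    have "i \<in> {1..N}" "i \<noteq> N" using that assms by auto
    then show ?thesis using assms(1) by simp
  qed
  have down: "j - 1 = 0 \<or> j - 1 \<in> B \<union> C" if "j \<in> C" for j
  proof -
    have "j \<in> {1..N}" using that assms(1) by auto
    then show ?thesis unfolding assms(1) by auto
  qed
  have "C = {i \<in> C. Suc i \<in> B} \<union> {i \<in> C. Suc i \<in> C}"
    using up by auto
  then have "\<Sum>C = \<Sum>{i \<in> C. Suc i \<in> B} + \<Sum>{i \<in> C. Suc i \<in> C}"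
    using fin assms(2) sum.union_disjoint[of "{i \<in> C. Suc i \<in> B}" "{i \<in> C. Suc i \<in> C}" "\<lambda>i. i"]
    by fastforce
  moreover have "\<Sum>C = (\<Sum>j\<in>C. j - 1) + card C"
    using pos by (simp add: sum.distrib[symmetric] card_eq_sum del: sum_constant)
  moreover have "(\<Sum>j\<in>C. j - 1) = \<Sum>{i \<in> B. Suc i \<in> C} + \<Sum>{i \<in> C. Suc i \<in> C}"
  proof -
    let ?S = "{i \<in> B. Suc i \<in> C} \<union> {i \<in> C. Suc i \<in> C}"
    have "Suc ` ?S \<subseteq> C" by auto
    \<comment> \<open>Only \<open>j = 1\<close> can be missed, since its predecessor
      \<open>0\<close> lies in neither set; its term vanishes.\<close>
    moreover have "j - 1 = 0" if "j \<in> C - Suc ` ?S" for j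
    proof (rule ccontr)
      assume "j - 1 \<noteq> 0"
      then have "j - 1 \<in> ?S" "j = Suc (j - 1)" using down[of j] that by auto
      then show False using that by blast
    qed
    ultimately have "(\<Sum>j\<in>C. j - 1) = (\<Sum>j\<in>Suc ` ?S. j - 1)"
      using fin by (intro sum.mono_neutral_right) auto
    also have "\<dots> = \<Sum>?S"
      by (simp add: sum.reindex)
    also have "\<dots> = \<Sum>{i \<in> B. Suc i \<in> C} + \<Sum>{i \<in> C. Suc i \<in> C}"
      using fin assms(2) by (intro sum.union_disjoint) auto
    finally show ?thesis .
  qed
  ultimately show ?thesis by simp
qed

section \<open>The bijection on arrays\<close>

definition rotate_array :: "array2 \<Rightarrow> array2" where
  "rotate_array T = (sorted_list_of_set (rotate_down (set (snd T)) ` set (fst T)), snd T)"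

lemma set_fst_rotate_array:
  "set (fst (rotate_array T)) = rotate_down (set (snd T)) ` set (fst T)"
  by (simp add: rotate_array_def)

lemma zero_notin_snd_RInc:
  assumes "T \<in> RInc k n"
  shows "0 \<notin> set (snd T)"
proof
  assume "0 \<in> set (snd T)"
  moreover have "set (snd T) \<subseteq> {1..2 * n - k}"
    using assms unfolding RInc_def by blast
  ultimately show False by auto
qed

lemma rotate_array_in_RInc:
  assumes T: "T \<in> RInc k n"
  shows "rotate_array T \<in> RInc k n"
proof -
  define A B where AB: "A = set (fst T)" "B = set (snd T)"
  let ?A' = "rotate_down B ` A"
  note B0 = zero_notin_snd_RInc[OF T, folded AB]
  have fin: "finite A" "finite B" by (auto simp: AB)
  from T have len: "length (fst T) = n" "length (snd T) = n"
    and sorted: "sorted_wrt (<) (fst T)" "sorted_wrt (<) (snd T)"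
    and cols: "\<forall>j<n. fst T ! j \<le> snd T ! j"
    and un: "A \<union> B = {1..2 * n - k}"
    by (auto simp: RInc_def AB)
  have "card ?A' = card A"
    using inj_rotate_down[OF fin(2) B0] by (metis card_image inj_on_subset subset_UNIV)
  also have "\<dots> = n"
    using sorted len by (simp add: AB strict_sorted_iff distinct_card)
  finally have len': "length (fst (rotate_array T)) = n"
    by (simp add: rotate_array_def AB)
  have sorted': "sorted_wrt (<) (fst (rotate_array T))"
    by (simp add: rotate_array_def)
  have "card {y \<in> B. y \<le> m} \<le> card {x \<in> A. x \<le> m}" for m
    using cols nth_le_nth_iff_card_le[OF sorted len] by (auto simp: AB)
  then have "card {y \<in> B. y \<le> m} \<le> card {x \<in> ?A'. x \<le> m}" for m
    using card_le_rotate_down[OF fin B0] by blast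
  then have cols': "\<forall>j<n. fst (rotate_array T) ! j \<le> snd T ! j"
    using nth_le_nth_iff_card_le[OF sorted' sorted(2) len' len(2)]
    by (simp add: set_fst_rotate_array AB)
  \<comment> \<open>Entries outside \<open>B\<close> are fixed and shared entries stay in
    \<open>B\<close>.\<close>
  have "?A' \<union> B = A \<union> B"
  proof
    show "?A' \<union> B \<subseteq> A \<union> B"
    proof
      fix y assume "y \<in> ?A' \<union> B"
      then consider x where "x \<in> A" "y = rotate_down B x" | "y \<in> B" by blast
      then show "y \<in> A \<union> B"
        using rotate_down_in[OF fin(2)] by cases (metis Un_iff rotate_down_notin, blast)
    qed
    show "A \<union> B \<subseteq> ?A' \<union> B"
    proof
      fix y assume y: "y \<in> A \<union> B"
      then show "y \<in> ?A' \<union> B"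
        using imageI[of y A "rotate_down B"] by (cases "y \<in> B") auto
    qed
  qed
  then show ?thesis
    using len len' sorted(2) sorted' cols' un
    by (auto simp: RInc_def set_fst_rotate_array AB rotate_array_def)
qed

lemma snd_rotate_array [simp]: "snd (rotate_array T) = snd T"
  by (simp add: rotate_array_def)

text \<open>The preserved second row determines the rotation, which can be undone on entry sets; an
  increasing row is determined by its entry set.\<close>

lemma inj_on_rotate_array: "inj_on rotate_array (RInc k n)"
proof (rule inj_onI)
  fix S T assume S: "S \<in> RInc k n" and T: "T \<in> RInc k n" and eq: "rotate_array S = rotate_array T"
  have snd: "snd S = snd T" using eq by (metis snd_rotate_array)
  moreover have "rotate_down (set (snd T)) ` set (fst S) = rotate_down (set (snd T)) ` set (fst T)"
    using eq snd set_fst_rotate_array by metis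
  then have "set (fst S) = set (fst T)"
    using inj_rotate_down[OF _ zero_notin_snd_RInc[OF T]] by (simp add: inj_image_eq_iff)
  then have "fst S = fst T"
    using S T by (intro strict_sorted_equal) (auto simp: RInc_def)
  ultimately show "S = T" by (simp add: prod_eq_iff)
qed

text \<open>Finiteness upgrades the injective self-map to a bijection without an explicit
  inverse.\<close>

lemma finite_RInc: "finite (RInc k n)"
proof -
  let ?L = "{xs. set xs \<subseteq> {1..2 * n - k} \<and> length xs = n}"
  have "RInc k n \<subseteq> ?L \<times> ?L" by (auto simp: RInc_def)
  then show ?thesis
    by (rule finite_subset) (intro finite_cartesian_product finite_lists_length_eq finite_atLeastAtMost)
qed

lemma maj_rotate_array:
  assumes "n \<ge> 1" "k \<le> n" and T: "T \<in> RInc k n"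
  shows "maj (rotate_array T) = amaj T + (n - k)"
proof -
  define A B where AB: "A = set (fst T)" "B = set (snd T)"
  define C where "C = A - B"
  define N where "N = 2 * n - k"
  note B0 = zero_notin_snd_RInc[OF T, folded AB]
  have fin: "finite A" "finite B" by (auto simp: AB)
  from T have len: "length (fst T) = n" "length (snd T) = n"
    and cols: "\<forall>j<n. fst T ! j \<le> snd T ! j"
    and un: "A \<union> B = {1..N}"
    by (auto simp: RInc_def AB N_def)
  \<comment> \<open>An occurrence of the maximum \<open>N\<close> in the first row forces
    \<open>N\<close> directly below it.\<close>
  have "N \<in> B"
  proof (rule ccontr)
    assume "N \<notin> B"
    moreover have "N \<in> {1..N}" using assms by (simp add: N_def)
    ultimately have "N \<in> A" using un by blast
    then obtain j where j: "j < n" "fst T ! j = N" using len by (auto simp: AB in_set_conv_nth)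
    then have "snd T ! j \<in> B" using len by (simp add: AB)
    moreover have "snd T ! j \<le> N" using \<open>snd T ! j \<in> B\<close> un by auto
    ultimately show False using j cols \<open>N \<notin> B\<close> by (metis le_antisym)
  qed
  have "card B = n"
    using T by (auto simp: RInc_def AB strict_sorted_iff distinct_card)
  have BC: "B \<union> C = {1..N}" "B \<inter> C = {}" using un by (auto simp: C_def)
  then have "card B + card C = N"
    using fin card_Un_disjoint[of B C] by (simp add: C_def)
  then have "card C = n - k" using \<open>card B = n\<close> assms by (simp add: N_def)

  \<comment> \<open>\<open>?D\<close> is common to the descents of the image and the ascents of
    \<open>T\<close>, so only the terms counted by \<open>sum_block_ends\<close> differ.\<close>
  let ?D = "{i \<in> B. Suc i \<in> A \<inter> B}"
  have "descents (rotate_array T) = {i \<in> C. Suc i \<in> B} \<union> ?D"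
  proof (intro set_eqI iffI)
    fix i assume "i \<in> descents (rotate_array T)"
    then obtain x where x: "x \<in> A" "i = rotate_down B x" "Suc i \<in> B"
      by (auto simp: descents_def set_fst_rotate_array AB)
    show "i \<in> {i \<in> C. Suc i \<in> B} \<union> ?D"
    proof (cases "x \<in> B")
      case True
      \<comment> \<open>As \<open>Suc i \<in> B\<close>, the element \<open>x\<close> did not wrap
        around, so \<open>x = Suc i\<close>.\<close>
      then show ?thesis
        using x Suc_rotate_down[OF fin(2) B0 True] rotate_down_in[OF fin(2) True] by auto
    qed (use x in \<open>auto simp: C_def\<close>)
  next
    fix i assume "i \<in> {i \<in> C. Suc i \<in> B} \<union> ?D"
    then consider "i \<in> C" "Suc i \<in> B" | "i \<in> B" "Suc i \<in> A" "Suc i \<in> B" by auto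
    then have "i \<in> rotate_down B ` A \<and> Suc i \<in> B"
    proof cases
      case 1
      then show ?thesis using rotate_down_notin[of i B] by (metis C_def DiffE imageI)
    next
      case 2
      then have "i = rotate_down B (Suc i)" by (simp add: rotate_down_def)
      then show ?thesis using 2 by blast
    qed
    then show "i \<in> descents (rotate_array T)"
      by (simp add: descents_def set_fst_rotate_array AB)
  qed
  moreover have "\<Sum>({i \<in> C. Suc i \<in> B} \<union> ?D) = \<Sum>{i \<in> C. Suc i \<in> B} + \<Sum>?D"
    using fin by (intro sum.union_disjoint) (auto simp: C_def)
  moreover have "ascents T = {i \<in> B. Suc i \<in> C} \<union> ?D"
    by (auto simp: ascents_def C_def AB)
  moreover have "\<Sum>({i \<in> B. Suc i \<in> C} \<union> ?D) = \<Sum>{i \<in> B. Suc i \<in> C} + \<Sum>?D"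
    using fin by (intro sum.union_disjoint) (auto simp: C_def)
  ultimately show ?thesis
    using sum_block_ends[OF BC \<open>N \<in> B\<close>] \<open>card C = n - k\<close>
    by (simp add: maj_def amaj_def)
qed

theorem theorem3p4:
  fixes n k :: nat
  assumes "n \<ge> 1" and "k \<le> n"
  shows "\<exists>\<Phi> :: array2 \<Rightarrow> array2.
    bij_betw \<Phi> (RInc k n) (RInc k n) \<and>
    (\<forall>T \<in> RInc k n. snd (\<Phi> T) = snd T \<and> maj (\<Phi> T) = amaj T + (n - k))"
proof (intro exI conjI ballI)
  show "bij_betw rotate_array (RInc k n) (RInc k n)"
    unfolding bij_betw_def
    using endo_inj_surj[OF finite_RInc _ inj_on_rotate_array] inj_on_rotate_array
      rotate_array_in_RInc by blast
qed (use maj_rotate_array assms in auto)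

end
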